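(* Let $G$ be a graph with $|V(G)|=n$ and let $H_1,\ldots,H_n$ be $n$ graphs. For each $i=1,\ldots,n$ let $\eta'_{Sg}(H_i)=\{b^i_1,b^i_2,\ldots,b^i_{s_i}\}$ (with $s_i$ elements) be a strong 2-geodetic basis of $H_i$. Then $\{b^1_1,\ldots,b^1_{s_1},b^2_1,\ldots,b^2_{s_2},\ldots,b^n_1,\ldots,b^n_{s_n}\}=\bigcup_{i=1}^n\eta'_{Sg}(H_i)$ is a strong geodetic basis of the generalized corona product $G\,\tilde{\circ}\,\Lambda_{i=1}^n H_i$, and the strong geodetic number is $Sg(G\,\tilde{\circ}\,\Lambda_{i=1}^n H_i)=\sum_{i=1}^n s_i$.
   Context: All graphs $G,H_1,H_2,\ldots$ are finite, simple, connected, and have at least two vertices. A geodesic between two vertices is a shortest path between them; $d$ denotes distance. Strong geodetic set: a set $\eta\subseteq V(X)$ of a graph $X$ such that one can fix, for each pair of distinct vertices $s,t\in\eta$, exactly one geodesic between $s$ and $t$ so that every vertex of $V(X)\setminus\eta$ lies on one of the fixed geodesics. The minimum cardinality of such a set is the strong geodetic number $Sg(X)$; a strong geodetic set of minimum cardinality is a strong geodetic basis. 2-geodesic: a geodesic between $x$ and $y$ with $1\le d(x,y)\le 2$. Strong 2-geodetic set: a set $\eta'\subseteq V(X)$ such that one can fix, for each pair $s,t\in\eta'$ with $1\le d(s,t)\le 2$, exactly one geodesic between $s$ and $t$ so that every vertex of $V(X)\setminus\eta'$ lies on one of the fixed geodesics. The minimum cardinality of such a set is the strong 2-geodetic number $Sg'(X)$;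 a strong 2-geodetic set of minimum cardinality is a strong 2-geodetic basis, denoted $\eta'_{Sg}(X)$. Generalized corona: for $V(G)=\{u_1,\ldots,u_n\}$ and graphs $H_1,\ldots,H_n$, the graph $G\,\tilde{\circ}\,\Lambda_{i=1}^n H_i$ is obtained by taking disjoint copies of $G,H_1,\ldots,H_n$ and joining $u_i$ to every vertex of $H_i$ for each $i$. *)

theory Defs
  imports "Graph_Theory.Graph_Theory"
begin

text \<open>
  A finite simple graph is a \<open>pair_graph\<close>: a finite, loopless set of arcs that is symmetric, the
  two arcs \<open>(u, v)\<close> and \<open>(v, u)\<close> together representing the edge \<open>uv\<close>.
\<close>

definition connected_simple_graph :: "'a pair_pre_digraph \<Rightarrow> bool" where
  "connected_simple_graph X \<longleftrightarrow>
     pair_graph X \<and> connected (with_proj X) \<and> 2 \<le> card (pverts X)"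

definition gdist :: "'a pair_pre_digraph \<Rightarrow> 'a \<Rightarrow> 'a \<Rightarrow> ereal" where
  "gdist X s t = wf_digraph.\<mu> (with_proj X) (\<lambda>_. 1) s t"

definition geodesic :: "'a pair_pre_digraph \<Rightarrow> 'a \<Rightarrow> 'a \<Rightarrow> 'a list \<Rightarrow> bool" where
  "geodesic X s t p \<longleftrightarrow>
     vpath p (with_proj X) \<and> hd p = s \<and> last p = t \<and>
     ereal (real (vwalk_length p)) = gdist X s t"

text \<open>
  A choice of geodesics is a function \<open>P\<close> on ordered pairs. Only one geodesic may be fixed for each
  \<^emph>\<open>unordered\<close> pair of vertices, so \<open>P t s\<close> has to be \<open>P s t\<close> traversed backwards.
\<close>

definition strong_geodetic_set :: "'a pair_pre_digraph \<Rightarrow> 'a set \<Rightarrow> bool" where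
  "strong_geodetic_set X \<eta> \<longleftrightarrow>
     \<eta> \<subseteq> pverts X \<and>
     (\<exists>P. (\<forall>s\<in>\<eta>. \<forall>t\<in>\<eta>. s \<noteq> t \<longrightarrow> geodesic X s t (P s t) \<and> P t s = rev (P s t)) \<and>
          (\<forall>v\<in>pverts X - \<eta>. \<exists>s\<in>\<eta>. \<exists>t\<in>\<eta>. s \<noteq> t \<and> v \<in> set (P s t)))"

definition strong_geodetic_number :: "'a pair_pre_digraph \<Rightarrow> nat" where
  "strong_geodetic_number X = (LEAST k. \<exists>\<eta>. strong_geodetic_set X \<eta> \<and> card \<eta> = k)"

definition strong_geodetic_basis :: "'a pair_pre_digraph \<Rightarrow> 'a set \<Rightarrow> bool" where
  "strong_geodetic_basis X \<eta> \<longleftrightarrow>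
     strong_geodetic_set X \<eta> \<and> card \<eta> = strong_geodetic_number X"

definition strong_2_geodetic_set :: "'a pair_pre_digraph \<Rightarrow> 'a set \<Rightarrow> bool" where
  "strong_2_geodetic_set X \<eta> \<longleftrightarrow>
     \<eta> \<subseteq> pverts X \<and>
     (\<exists>P. (\<forall>s\<in>\<eta>. \<forall>t\<in>\<eta>. 1 \<le> gdist X s t \<and> gdist X s t \<le> 2 \<longrightarrow>
             geodesic X s t (P s t) \<and> P t s = rev (P s t)) \<and>
          (\<forall>v\<in>pverts X - \<eta>. \<exists>s\<in>\<eta>. \<exists>t\<in>\<eta>.
             1 \<le> gdist X s t \<and> gdist X s t \<le> 2 \<and> v \<in> set (P s t)))"

definition strong_2_geodetic_number :: "'a pair_pre_digraph \<Rightarrow> nat" where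
  "strong_2_geodetic_number X = (LEAST k. \<exists>\<eta>. strong_2_geodetic_set X \<eta> \<and> card \<eta> = k)"

definition strong_2_geodetic_basis :: "'a pair_pre_digraph \<Rightarrow> 'a set \<Rightarrow> bool" where
  "strong_2_geodetic_basis X \<eta> \<longleftrightarrow>
     strong_2_geodetic_set X \<eta> \<and> card \<eta> = strong_2_geodetic_number X"

text \<open>
  The vertices of \<open>G\<close> are enumerated as \<open>u 1, \<dots>, u n\<close>. In the corona, \<open>Inl v\<close> is the copy of the
  vertex \<open>v\<close> of \<open>G\<close>, and \<open>Inr (i, x)\<close> is the copy of the vertex \<open>x\<close> of \<open>H i\<close>; the tag \<open>i\<close> makes the
  copies of \<open>H 1, \<dots>, H n\<close> disjoint.
\<close>

definition generalized_corona ::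
    "'a pair_pre_digraph \<Rightarrow> nat \<Rightarrow> (nat \<Rightarrow> 'a) \<Rightarrow> (nat \<Rightarrow> 'b pair_pre_digraph) \<Rightarrow>
     ('a + nat \<times> 'b) pair_pre_digraph" where
  "generalized_corona G n u H =
     \<lparr> pverts = Inl ` pverts G \<union> {Inr (i, x) | i x. i \<in> {1..n} \<and> x \<in> pverts (H i)},
       parcs = {(Inl v, Inl w) | v w. (v, w) \<in> parcs G}
             \<union> {(Inr (i, x), Inr (i, y)) | i x y. i \<in> {1..n} \<and> (x, y) \<in> parcs (H i)}
             \<union> {(Inl (u i), Inr (i, x)) | i x. i \<in> {1..n} \<and> x \<in> pverts (H i)}
             \<union> {(Inr (i, x), Inl (u i)) | i x. i \<in> {1..n} \<and> x \<in> pverts (H i)} \<rparr>"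

end

theory Submission
  imports Defs
begin

text \<open>
  A vertex \<open>x\<close> of a copy of \<open>H i\<close> can be reached from outside that copy only through \<open>u i\<close>, and
  \<open>u i\<close> is adjacent to the whole copy. Hence any two vertices of the copy are at distance at most
  \<open>2\<close> in the corona, a geodesic with only one end in the copy meets the copy in that end alone, and a
  geodesic with no end in it avoids it. The one way to cover \<open>x\<close> by a geodesic that does not end in
  \<open>x\<close> is therefore a path \<open>y, x, z\<close> inside the copy, with \<open>y\<close> and \<open>z\<close> at distance \<open>2\<close> in \<open>H i\<close>
  (lemma \<open>geodesic_through_copy\<close>).

  Such paths are exactly what a strong \<open>2\<close>-geodetic set of \<open>H i\<close> is about: geodesics between adjacent
  vertices cover nothing new, so such a set amounts to a choice of a middle vertex for each unordered
  pair at distance \<open>2\<close> (lemma \<open>strong_2_geodetic_set_iff_middles\<close>).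

  Lower bound (\<open>trace_strong_2_geodetic\<close>): any strong geodetic set of the corona restricts to a strong
  \<open>2\<close>-geodetic set of each \<open>H i\<close>, so it has at least \<open>s i\<close> elements in the copy of \<open>H i\<close>, and the copies
  are disjoint.

  Upper bound (\<open>union_strong_geodetic\<close>): the union of the bases is a strong geodetic set. Inside a copy
  one uses the middle vertices chosen there, and this covers the copy. Between copies \<open>i \<noteq> j\<close> one
  extends a geodesic of \<open>G\<close> from \<open>u i\<close> to \<open>u j\<close> by one edge at each end. As \<open>n \<ge> 2\<close> and no basis
  is empty, every \<open>u i\<close> lies on one of these paths.
\<close>

section \<open>Geodesics as shortest walks\<close>

definition adjacent :: "'a pair_pre_digraph \<Rightarrow> 'a \<Rightarrow> 'a \<Rightarrow> bool" where
  "adjacent X a b \<longleftrightarrow> (a, b) \<in> parcs X"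

definition walk_betw :: "'a pair_pre_digraph \<Rightarrow> 'a \<Rightarrow> 'a list \<Rightarrow> 'a \<Rightarrow> bool" where
  "walk_betw X s p t \<longleftrightarrow>
     p \<noteq> [] \<and> set p \<subseteq> pverts X \<and> successively (adjacent X) p \<and> hd p = s \<and> last p = t"

lemma vwalk_arcs_subset_iff_successively:
  "set (vwalk_arcs p) \<subseteq> parcs X \<longleftrightarrow> successively (adjacent X) p"
  by (induction p rule: vwalk_arcs.induct) (auto simp: adjacent_def)

lemma walk_betw_iff_vwalk:
  "walk_betw X s p t \<longleftrightarrow> vwalk p (with_proj X) \<and> hd p = s \<and> last p = t"
  by (auto simp: walk_betw_def vwalk_def vwalk_arcs_subset_iff_successively)

lemma walk_betw_imp_awalk:
  assumes "pair_wf_digraph X" "walk_betw X s p t"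
  shows "pre_digraph.awalk (with_proj X) s (vwalk_arcs p) t"
proof -
  interpret pair_wf_digraph X by fact
  show ?thesis
    using assms(2)
  proof (induction p arbitrary: s rule: vwalk_arcs.induct)
    case (3 x y xs)
    then have "walk_betw X y (y # xs) t" by (auto simp: walk_betw_def)
    with 3 show ?case by (auto simp: walk_betw_def awalk_Cons_iff adjacent_def)
  qed (auto simp: walk_betw_def awalk_Nil_iff)
qed

lemma awalk_imp_walk_betw:
  assumes "pair_wf_digraph X" "pre_digraph.awalk (with_proj X) s es t"
  shows "walk_betw X s (pre_digraph.awalk_verts (with_proj X) s es) t"
    "length (pre_digraph.awalk_verts (with_proj X) s es) = Suc (length es)"
proof -
  interpret pair_wf_digraph X by fact
  show "walk_betw X s (pre_digraph.awalk_verts (with_proj X) s es) t"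
    using assms(2)
  proof (induction es arbitrary: s)
    case (Cons e es)
    obtain x y where e: "e = (x, y)" by force
    with Cons have "walk_betw X y (pawalk_verts y es) t" "x = s" "(x, y) \<in> parcs X"
      by (auto simp: awalk_Cons_iff)
    with e show ?case
      by (cases "pawalk_verts y es") (auto simp: walk_betw_def adjacent_def dest: wellformed')
  qed (auto simp: walk_betw_def awalk_Nil_iff)
  show "length (pre_digraph.awalk_verts (with_proj X) s es) = Suc (length es)"
    unfolding awalk_verts_with_proj_eq by (induction es arbitrary: s) auto
qed

text \<open>
  The library measures distance as an infimum of costs of arc lists. In a graph without parallel arcs
  the arc lists of walks and their vertex lists determine each other, so that everything below can be
  argued on vertex lists.
\<close>

lemma gdist_eq_INF_walks:
  assumes "pair_wf_digraph X"
  shows "gdist X s t = (INF p\<in>{p. walk_betw X s p t}. ereal (real (length p - 1)))"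
proof -
  interpret pair_wf_digraph X by fact
  have "{ereal (awalk_cost (\<lambda>_. 1) es) | es. awalk s es t}
      = {ereal (real (length p - 1)) | p. walk_betw X s p t}" (is "?A = ?B")
  proof
    show "?A \<subseteq> ?B"
    proof
      fix c assume "c \<in> ?A"
      then obtain es where "awalk s es t" "c = ereal (real (length es))"
        by (auto simp: awalk_cost_def sum_list_triv)
      with awalk_imp_walk_betw[OF assms, of s es t] show "c \<in> ?B"
        by (intro CollectI exI[of _ "pawalk_verts s es"]) auto
    qed
    show "?B \<subseteq> ?A"
    proof
      fix c assume "c \<in> ?B"
      then obtain p where "walk_betw X s p t" "c = ereal (real (length p - 1))" by blast
      with walk_betw_imp_awalk[OF assms, of s p t] show "c \<in> ?A"
        using vwalk_length_simp[of p]
        by (intro CollectI exI[of _ "vwalk_arcs p"])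
          (auto simp: awalk_cost_def sum_list_triv vwalk_length_def simp del: vwalk_length_simp)
    qed
  qed
  then show ?thesis
    by (simp add: gdist_def \<mu>_def image_Collect)
qed

text \<open>
  Cutting and gluing walks at a vertex; used from right to left it shortens a walk by replacing one of
  its two halves.
\<close>

lemma walk_betw_append_iff:
  "walk_betw X s (xs @ y # ys) t \<longleftrightarrow> walk_betw X s (xs @ [y]) y \<and> walk_betw X y (y # ys) t"
  by (auto simp: walk_betw_def successively_append_iff successively_Cons hd_append)

text \<open>
  The part of a walk between two visits of the same vertex can be cut out.
\<close>

lemma shortest_walk_distinct:
  assumes "walk_betw X s p t"
    and "\<And>q. walk_betw X s q t \<Longrightarrow> length p \<le> length q"
  shows "distinct p"
proof (rule ccontr)
  assume "\<not> distinct p"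
  then obtain xs y ys zs where p: "p = xs @ [y] @ ys @ [y] @ zs"
    using not_distinct_decomp by blast
  have "walk_betw X s (xs @ y # zs) t"
    using assms(1) walk_betw_append_iff[of X s xs y "ys @ y # zs" t]
      walk_betw_append_iff[of X y "y # ys" y zs t] walk_betw_append_iff[of X s xs y zs t]
    by (simp add: p)
  from assms(2)[OF this] show False by (simp add: p)
qed

text \<open>
  To recognise a geodesic it is enough to compare lengths of walks: no infimum of extended reals has to
  be evaluated, and distinctness of the vertices comes for free.
\<close>

lemma geodesic_iff_shortest_walk:
  assumes "pair_wf_digraph X"
  shows "geodesic X s t p \<longleftrightarrow>
    walk_betw X s p t \<and> (\<forall>q. walk_betw X s q t \<longrightarrow> length p \<le> length q)"
proof
  assume "geodesic X s t p"
  then have p: "walk_betw X s p t"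
    and min: "ereal (real (length p - 1)) = (INF p\<in>{p. walk_betw X s p t}. ereal (real (length p - 1)))"
    by (auto simp: geodesic_def walk_betw_iff_vwalk vpath_def gdist_eq_INF_walks[OF assms])
  have "length p \<le> length q" if "walk_betw X s q t" for q
  proof -
    have "ereal (real (length p - 1)) \<le> ereal (real (length q - 1))"
      unfolding min using that by (intro INF_lower) auto
    moreover have "p \<noteq> []" "q \<noteq> []" using p that by (auto simp: walk_betw_def)
    ultimately show ?thesis by (cases p; cases q) auto
  qed
  with p show "walk_betw X s p t \<and> (\<forall>q. walk_betw X s q t \<longrightarrow> length p \<le> length q)" by blast
next
  assume *: "walk_betw X s p t \<and> (\<forall>q. walk_betw X s q t \<longrightarrow> length p \<le> length q)"
  then have "ereal (real (length p - 1)) = (INF p\<in>{p. walk_betw X s p t}. ereal (real (length p - 1)))"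
    by (intro INF_eqI[symmetric]) (auto simp: diff_le_mono)
  moreover have "distinct p"
    by (rule shortest_walk_distinct[of X s p t]) (use * in simp_all)
  ultimately show "geodesic X s t p"
    using * by (auto simp: geodesic_def walk_betw_iff_vwalk vpath_def gdist_eq_INF_walks[OF assms])
qed

lemma short_walk_betw_iff:
  assumes "pair_wf_digraph X"
  shows "walk_betw X s [a] t \<longleftrightarrow> s = a \<and> t = a \<and> a \<in> pverts X"
    and "walk_betw X s [a, b] t \<longleftrightarrow> s = a \<and> t = b \<and> adjacent X a b"
    and "walk_betw X s [a, b, c] t \<longleftrightarrow> s = a \<and> t = c \<and> adjacent X a b \<and> adjacent X b c"
  using assms by (auto simp: walk_betw_def adjacent_def pair_wf_digraph_def)

lemma walk_betw_rev:
  assumes "pair_sym_digraph X" "walk_betw X s p t"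
  shows "walk_betw X t (rev p) s"
proof -
  interpret pair_sym_digraph X by fact
  have "(\<lambda>x y. adjacent X y x) = adjacent X"
    by (auto simp: fun_eq_iff adjacent_def arcs_symmetric)
  then have "successively (adjacent X) (rev p) = successively (adjacent X) p"
    by (simp only: successively_rev)
  with assms(2) show ?thesis
    by (simp add: walk_betw_def hd_rev last_rev)
qed

lemma geodesic_rev:
  assumes "pair_sym_digraph X" "geodesic X s t p"
  shows "geodesic X t s (rev p)"
proof -
  have wf: "pair_wf_digraph X" using assms(1) by (simp add: pair_sym_digraph_def)
  note p = iffD1[OF geodesic_iff_shortest_walk[OF wf] assms(2)]
  have "length (rev p) \<le> length q" if "walk_betw X t q s" for q
  proof -
    have "walk_betw X s (rev q) t" using walk_betw_rev[OF assms(1) that] .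
    with p have "length p \<le> length (rev q)" by blast
    then show ?thesis by simp
  qed
  moreover have "walk_betw X t (rev p) s" using p walk_betw_rev[OF assms(1)] by blast
  ultimately show ?thesis
    unfolding geodesic_iff_shortest_walk[OF wf] by blast
qed

lemma list_length_le_3_cases [consumes 2, case_names One Two Three]:
  assumes "p \<noteq> []" "length p \<le> 3"
  obtains a where "p = [a]" | a b where "p = [a, b]" | a b c where "p = [a, b, c]"
  using assms by (auto simp: numeral_3_eq_3 le_Suc_eq length_Suc_conv)

lemma geodesic_adjacent_iff:
  assumes "pair_wf_digraph X" "adjacent X s t" "s \<noteq> t"
  shows "geodesic X s t p \<longleftrightarrow> p = [s, t]"
proof -
  note geod = geodesic_iff_shortest_walk[OF assms(1)]
  have long: "length [s, t] \<le> length q" if "walk_betw X s q t" for q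
    using that \<open>s \<noteq> t\<close> by (cases q; cases "tl q") (auto simp: walk_betw_def)
  have st: "walk_betw X s [s, t] t"
    using assms by (simp add: short_walk_betw_iff)
  show ?thesis
  proof
    assume "geodesic X s t p"
    with st have p: "walk_betw X s p t" "length p \<le> length [s, t]"
      unfolding geod by blast+
    then have "p \<noteq> []" "length p \<le> 3" by (simp_all add: walk_betw_def)
    then show "p = [s, t]"
      using p \<open>s \<noteq> t\<close> by (cases rule: list_length_le_3_cases) (auto simp: walk_betw_def)
  next
    assume "p = [s, t]"
    with st long show "geodesic X s t p" unfolding geod by blast
  qed
qed

lemma nonadjacent_walk_length:
  assumes "pair_wf_digraph X" "\<not> adjacent X s t" "s \<noteq> t" "walk_betw X s q t"
  shows "3 \<le> length q"
proof (rule ccontr)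
  assume short: "\<not> 3 \<le> length q"
  then have "q \<noteq> []" "length q \<le> 3" using assms by (simp_all add: walk_betw_def)
  then show False
    using assms short
    by (cases rule: list_length_le_3_cases) (auto simp: short_walk_betw_iff)
qed

definition dist_two :: "'a pair_pre_digraph \<Rightarrow> 'a \<Rightarrow> 'a \<Rightarrow> bool" where
  "dist_two X s t \<longleftrightarrow> s \<noteq> t \<and> \<not> adjacent X s t \<and> (\<exists>w. adjacent X s w \<and> adjacent X w t)"

lemma geodesic_dist_two_iff:
  assumes "pair_wf_digraph X" "dist_two X s t"
  shows "geodesic X s t p \<longleftrightarrow> (\<exists>w. p = [s, w, t] \<and> adjacent X s w \<and> adjacent X w t)"
proof -
  note geod = geodesic_iff_shortest_walk[OF assms(1)]
  from assms(2) obtain w where w: "adjacent X s w" "adjacent X w t"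
    and far: "\<not> adjacent X s t" "s \<noteq> t"
    by (auto simp: dist_two_def)
  note long = nonadjacent_walk_length[OF assms(1) far]
  have swt: "walk_betw X s [s, w, t] t"
    using w by (simp add: short_walk_betw_iff[OF assms(1)])
  show ?thesis
  proof
    assume "geodesic X s t p"
    with swt have p: "walk_betw X s p t" "length p \<le> length [s, w, t]"
      unfolding geod by blast+
    then have "p \<noteq> []" "length p \<le> 3" by (simp_all add: walk_betw_def)
    then show "\<exists>w. p = [s, w, t] \<and> adjacent X s w \<and> adjacent X w t"
      using p long[OF p(1)]
      by (cases rule: list_length_le_3_cases) (auto simp: short_walk_betw_iff[OF assms(1)])
  next
    assume "\<exists>w. p = [s, w, t] \<and> adjacent X s w \<and> adjacent X w t"
    then have "walk_betw X s p t" "length p = 3"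
      by (auto simp: short_walk_betw_iff[OF assms(1)])
    with long show "geodesic X s t p" unfolding geod by simp
  qed
qed

text \<open>
  Distances are integers or infinite, so one between \<open>1\<close> and \<open>2\<close> is one of the two: it is either realised
  by an edge or by a path through a common neighbour.
\<close>

lemma gdist_one_two_iff:
  assumes "pair_graph X" "s \<in> pverts X"
  shows "1 \<le> gdist X s t \<and> gdist X s t \<le> 2 \<longleftrightarrow> adjacent X s t \<or> dist_two X s t"
proof -
  interpret pair_graph X by fact
  note wf = pair_wf_digraph
  note gd = gdist_eq_INF_walks[OF wf, of s t]
  have nz: "1 \<le> gdist X s t \<longleftrightarrow> s \<noteq> t"
  proof
    assume "1 \<le> gdist X s t"
    show "s \<noteq> t"
    proof
      assume "s = t"
      then have "walk_betw X s [s] t" using assms by (simp add: short_walk_betw_iff[OF wf])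
      then have "gdist X s t \<le> ereal (real (length [s] - 1))"
        unfolding gd by (intro INF_lower) auto
      then have "gdist X s t \<le> 0" by (simp add: zero_ereal_def)
      with \<open>1 \<le> gdist X s t\<close> have "(1::ereal) \<le> 0" by (rule order_trans)
      then show False by simp
    qed
  next
    assume "s \<noteq> t"
    have "1 \<le> ereal (real (length q - 1))" if "walk_betw X s q t" for q
      using that \<open>s \<noteq> t\<close> by (cases q; cases "tl q") (auto simp: walk_betw_def)
    then show "1 \<le> gdist X s t" unfolding gd by (intro INF_greatest) auto
  qed
  have le2: "gdist X s t \<le> 2 \<longleftrightarrow> (\<exists>q. walk_betw X s q t \<and> length q \<le> 3)"
  proof
    assume "gdist X s t \<le> 2"
    then have "gdist X s t < ereal 3" by (rule le_less_trans) simp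
    then show "\<exists>q. walk_betw X s q t \<and> length q \<le> 3"
      unfolding gd INF_less_iff by auto
  next
    assume "\<exists>q. walk_betw X s q t \<and> length q \<le> 3"
    then obtain q where q: "walk_betw X s q t" "length q \<le> 3" by blast
    then have "gdist X s t \<le> ereal (real (length q - 1))" unfolding gd by (intro INF_lower) auto
    also have "\<dots> \<le> 2" using q(2) by (simp add: numeral_eq_ereal)
    finally show "gdist X s t \<le> 2" .
  qed
  have "(\<exists>q. walk_betw X s q t \<and> length q \<le> 3) \<longleftrightarrow> adjacent X s t \<or> dist_two X s t" if "s \<noteq> t"
  proof
    assume "\<exists>q. walk_betw X s q t \<and> length q \<le> 3"
    then obtain q where q: "walk_betw X s q t" "length q \<le> 3" by blast
    then have "q \<noteq> []" by (simp add: walk_betw_def)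
    from this q(2) show "adjacent X s t \<or> dist_two X s t"
      using q that
      by (cases rule: list_length_le_3_cases) (auto simp: short_walk_betw_iff[OF wf] dist_two_def)
  next
    assume "adjacent X s t \<or> dist_two X s t"
    then show "\<exists>q. walk_betw X s q t \<and> length q \<le> 3"
    proof
      assume "adjacent X s t"
      then have "walk_betw X s [s, t] t" by (simp add: short_walk_betw_iff[OF wf])
      then show ?thesis by (rule_tac exI[of _ "[s, t]"]) simp
    next
      assume "dist_two X s t"
      then obtain w where "walk_betw X s [s, w, t] t"
        by (auto simp: short_walk_betw_iff[OF wf] dist_two_def)
      then show ?thesis by (rule_tac exI[of _ "[s, w, t]"]) simp
    qed
  qed
  moreover have "\<not> adjacent X s s" using no_loops' by (auto simp: adjacent_def)
  ultimately show ?thesis unfolding nz le2 by (cases "s = t") (simp_all add: dist_two_def)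
qed

lemma ex_geodesic:
  assumes "connected_simple_graph X" "s \<in> pverts X" "t \<in> pverts X"
  shows "\<exists>p. geodesic X s t p"
proof -
  interpret pair_graph X using assms by (simp add: connected_simple_graph_def)
  have "s \<rightarrow>\<^sup>*\<^bsub>with_proj X\<^esub> t"
    using assms reachable_mk_symmetric_eq[of s t] sym_arcs
    by (auto simp: connected_simple_graph_def connected_def strongly_connected_def)
  then obtain q where "walk_betw X s q t"
    using reachable_vwalk_conv[of s t] by (auto simp: walk_betw_iff_vwalk)
  then have "\<exists>p. walk_betw X s p t \<and> (\<forall>q. walk_betw X s q t \<longrightarrow> length p \<le> length q)"
    by (rule ex_has_least_nat)
  then show ?thesis by (simp add: geodesic_iff_shortest_walk[OF pair_wf_digraph])
qed

section \<open>Strong 2-geodetic sets and middle vertices\<close>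

lemma adjacent_sym:
  assumes "pair_sym_digraph X"
  shows "adjacent X a b \<longleftrightarrow> adjacent X b a"
proof -
  interpret pair_sym_digraph X by fact
  show ?thesis by (auto simp: adjacent_def arcs_symmetric)
qed

lemma dist_two_sym:
  assumes "pair_sym_digraph X"
  shows "dist_two X s t \<longleftrightarrow> dist_two X t s"
  unfolding dist_two_def using adjacent_sym[OF assms] by blast

text \<open>
  \<open>m\<close> fixes the geodesics \<open>s, m s t, t\<close>. The condition \<open>m t s = m s t\<close> is what makes this one geodesic
  for each unordered pair.
\<close>

definition middle_selection :: "'a pair_pre_digraph \<Rightarrow> 'a set \<Rightarrow> ('a \<Rightarrow> 'a \<Rightarrow> 'a) \<Rightarrow> bool" where
  "middle_selection X \<eta> m \<longleftrightarrow>
     (\<forall>s\<in>\<eta>. \<forall>t\<in>\<eta>. dist_two X s t \<longrightarrow>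
        adjacent X s (m s t) \<and> adjacent X (m s t) t \<and> m t s = m s t) \<and>
     (\<forall>v\<in>pverts X - \<eta>. \<exists>s\<in>\<eta>. \<exists>t\<in>\<eta>. dist_two X s t \<and> v = m s t)"

text \<open>
  The geodesic between adjacent vertices is the edge, which contains no vertex outside \<open>\<eta>\<close>. Only the
  pairs at distance \<open>2\<close> matter, and a geodesic between them is determined by its middle vertex.
\<close>

lemma strong_2_geodetic_set_iff_middles:
  assumes "pair_graph X"
  shows "strong_2_geodetic_set X \<eta> \<longleftrightarrow> \<eta> \<subseteq> pverts X \<and> (\<exists>m. middle_selection X \<eta> m)"
    (is "?L \<longleftrightarrow> ?R")
proof -
  interpret pair_graph X by fact
  have sym: "pair_sym_digraph X" by unfold_locales
  note wf = pair_wf_digraph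
  have loopfree: "a \<noteq> b" if "adjacent X a b" for a b
    using that no_loops' by (auto simp: adjacent_def)
  note adj = geodesic_adjacent_iff[OF wf _ loopfree]
  note two = geodesic_dist_two_iff[OF wf]
  have exclusive: "\<not> (adjacent X s t \<and> dist_two X s t)" for s t by (simp add: dist_two_def)
  show ?thesis
  proof
    assume L: ?L
    then have sub: "\<eta> \<subseteq> pverts X" by (simp add: strong_2_geodetic_set_def)
    then have range: "1 \<le> gdist X s t \<and> gdist X s t \<le> 2 \<longleftrightarrow> adjacent X s t \<or> dist_two X s t"
      if "s \<in> \<eta>" for s t using that gdist_one_two_iff[OF assms] by blast
    from L obtain P where
      P0: "\<forall>s\<in>\<eta>. \<forall>t\<in>\<eta>. 1 \<le> gdist X s t \<and> gdist X s t \<le> 2 \<longrightarrow>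
             geodesic X s t (P s t) \<and> P t s = rev (P s t)"
      and cover0: "\<forall>v\<in>pverts X - \<eta>. \<exists>s\<in>\<eta>. \<exists>t\<in>\<eta>.
             1 \<le> gdist X s t \<and> gdist X s t \<le> 2 \<and> v \<in> set (P s t)"
      unfolding strong_2_geodetic_set_def by (elim conjE exE)
    have P: "geodesic X s t (P s t) \<and> P t s = rev (P s t)"
      if "s \<in> \<eta>" "t \<in> \<eta>" "adjacent X s t \<or> dist_two X s t" for s t
      using P0[rule_format, OF that(1,2)] range[OF that(1), of t] that(3) by simp
    have cover: "\<exists>s\<in>\<eta>. \<exists>t\<in>\<eta>. (adjacent X s t \<or> dist_two X s t) \<and> v \<in> set (P s t)"
      if v: "v \<in> pverts X - \<eta>" for v
    proof -
      from cover0[rule_format, OF v] obtain s t where "s \<in> \<eta>" "t \<in> \<eta>" "v \<in> set (P s t)"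
        "1 \<le> gdist X s t \<and> gdist X s t \<le> 2" by blast
      with range[of s t] show ?thesis by blast
    qed
    define m where "m s t = P s t ! 1" for s t
    have mid: "P s t = [s, m s t, t] \<and> adjacent X s (m s t) \<and> adjacent X (m s t) t"
      if "s \<in> \<eta>" "t \<in> \<eta>" "dist_two X s t" for s t
      using P[OF that(1,2)] two[OF that(3)] that(3) by (auto simp: m_def)
    have "middle_selection X \<eta> m"
      unfolding middle_selection_def
    proof (intro conjI ballI impI)
      fix s t assume st: "s \<in> \<eta>" "t \<in> \<eta>" "dist_two X s t"
      then have "dist_two X t s" using dist_two_sym[OF sym] by blast
      then show "adjacent X s (m s t)" "adjacent X (m s t) t" "m t s = m s t"
        using mid[of s t] mid[of t s] P[of s t] st by auto
    next
      fix v assume v: "v \<in> pverts X - \<eta>"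
      then obtain s t where st: "s \<in> \<eta>" "t \<in> \<eta>" "adjacent X s t \<or> dist_two X s t" "v \<in> set (P s t)"
        using cover by blast
      have "\<not> adjacent X s t"
      proof
        assume "adjacent X s t"
        then have "P s t = [s, t]" using P[OF st(1-3)] adj by blast
        with st v show False by auto
      qed
      then have "dist_two X s t" using st by blast
      moreover from this have "v = m s t" using mid st v by fastforce
      ultimately show "\<exists>s\<in>\<eta>. \<exists>t\<in>\<eta>. dist_two X s t \<and> v = m s t" using st by blast
    qed
    with sub show ?R by blast
  next
    assume ?R
    then obtain m where sub: "\<eta> \<subseteq> pverts X" and sel: "middle_selection X \<eta> m" by blast
    note m = conjunct1[OF sel[unfolded middle_selection_def]]
      conjunct2[OF sel[unfolded middle_selection_def]]
    from sub have range: "1 \<le> gdist X s t \<and> gdist X s t \<le> 2 \<longleftrightarrow> adjacent X s t \<or> dist_two X s t"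
      if "s \<in> \<eta>" for s t using that gdist_one_two_iff[OF assms] by blast
    define P where "P s t = (if adjacent X s t then [s, t] else [s, m s t, t])" for s t
    have P: "geodesic X s t (P s t) \<and> P t s = rev (P s t)"
      if st: "s \<in> \<eta>" "t \<in> \<eta>" "adjacent X s t \<or> dist_two X s t" for s t
      using st(3)
    proof
      assume "adjacent X s t"
      then show ?thesis using adj[of s t] adjacent_sym[OF sym, of s t] by (simp add: P_def)
    next
      assume d: "dist_two X s t"
      then have "\<not> adjacent X s t" "\<not> adjacent X t s"
        using adjacent_sym[OF sym, of s t] by (simp_all add: dist_two_def)
      then show ?thesis using two[OF d] m(1) st d by (simp add: P_def)
    qed
    have cover: "\<exists>s\<in>\<eta>. \<exists>t\<in>\<eta>. (adjacent X s t \<or> dist_two X s t) \<and> v \<in> set (P s t)"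
      if v: "v \<in> pverts X - \<eta>" for v
    proof -
      from m(2) v obtain s t where st: "s \<in> \<eta>" "t \<in> \<eta>" "dist_two X s t" "v = m s t" by blast
      then have "v \<in> set (P s t)" by (simp add: P_def dist_two_def)
      with st show ?thesis by blast
    qed
    show ?L
      unfolding strong_2_geodetic_set_def
    proof (intro conjI exI[of _ P] ballI impI)
      fix s t assume "s \<in> \<eta>" "t \<in> \<eta>" "1 \<le> gdist X s t \<and> gdist X s t \<le> 2"
      then show "geodesic X s t (P s t)" "P t s = rev (P s t)" using P[of s t] range[of s t] by blast+
    next
      fix v assume "v \<in> pverts X - \<eta>"
      then show "\<exists>s\<in>\<eta>. \<exists>t\<in>\<eta>. 1 \<le> gdist X s t \<and> gdist X s t \<le> 2 \<and> v \<in> set (P s t)"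
      proof -
        from cover[OF \<open>v \<in> pverts X - \<eta>\<close>] obtain s t
          where "s \<in> \<eta>" "t \<in> \<eta>" "v \<in> set (P s t)" "adjacent X s t \<or> dist_two X s t" by blast
        with range[of s t] show ?thesis by blast
      qed
    qed (rule sub)
  qed
qed

lemma strong_2_geodetic_set_nonempty:
  assumes "strong_2_geodetic_set X \<eta>" "pverts X \<noteq> {}"
  shows "\<eta> \<noteq> {}"
  using assms by (auto simp: strong_2_geodetic_set_def)

section \<open>Geodesics in the generalized corona\<close>

locale corona =
  fixes G :: "'a pair_pre_digraph" and n :: nat and u :: "nat \<Rightarrow> 'a"
    and H :: "nat \<Rightarrow> 'b pair_pre_digraph"
  assumes base: "connected_simple_graph G"
    and u_bij: "bij_betw u {1..n} (pverts G)"
    and fibre: "\<And>i. i \<in> {1..n} \<Longrightarrow> connected_simple_graph (H i)"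
begin

abbreviation "C \<equiv> generalized_corona G n u H"

lemma base_graph: "pair_graph G" and fibre_graph: "i \<in> {1..n} \<Longrightarrow> pair_graph (H i)"
  using base fibre by (auto simp: connected_simple_graph_def)

lemma base_wf: "pair_wf_digraph G" and base_sym: "pair_sym_digraph G"
proof -
  interpret pair_graph G by (rule base_graph)
  show "pair_wf_digraph G" "pair_sym_digraph G" by unfold_locales
qed

lemma fibre_wf: "i \<in> {1..n} \<Longrightarrow> pair_wf_digraph (H i)"
  and fibre_sym: "i \<in> {1..n} \<Longrightarrow> pair_sym_digraph (H i)"
  and finite_fibre: "i \<in> {1..n} \<Longrightarrow> finite (pverts (H i))"
proof -
  assume "i \<in> {1..n}"
  then interpret pair_graph "H i" by (rule fibre_graph)
  show "pair_wf_digraph (H i)" "pair_sym_digraph (H i)" "finite (pverts (H i))"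
    by unfold_locales (rule pair_finite_verts)
qed

lemma u_in_base: "i \<in> {1..n} \<Longrightarrow> u i \<in> pverts G"
  using u_bij by (auto simp: bij_betw_def)

lemma u_inj: "i \<in> {1..n} \<Longrightarrow> j \<in> {1..n} \<Longrightarrow> u i = u j \<longleftrightarrow> i = j"
  by (rule inj_on_eq_iff[OF bij_betw_imp_inj_on[OF u_bij]])

lemma in_corona [simp]:
  "Inl v \<in> pverts C \<longleftrightarrow> v \<in> pverts G"
  "Inr (i, x) \<in> pverts C \<longleftrightarrow> i \<in> {1..n} \<and> x \<in> pverts (H i)"
  by (auto simp: generalized_corona_def)

lemma adjacent_corona [simp]:
  "adjacent C (Inl v) (Inl w) \<longleftrightarrow> adjacent G v w"
  "adjacent C (Inr (i, x)) (Inr (j, y)) \<longleftrightarrow> i = j \<and> i \<in> {1..n} \<and> adjacent (H i) x y"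
  "adjacent C (Inl v) (Inr (i, x)) \<longleftrightarrow> v = u i \<and> i \<in> {1..n} \<and> x \<in> pverts (H i)"
  "adjacent C (Inr (i, x)) (Inl v) \<longleftrightarrow> v = u i \<and> i \<in> {1..n} \<and> x \<in> pverts (H i)"
  by (auto simp: adjacent_def generalized_corona_def)

lemma corona_sym: "pair_sym_digraph C"
proof
  have arcs_in: "a \<in> pverts C \<and> b \<in> pverts C \<and> adjacent C b a" if "adjacent C a b" for a b
  proof -
    have G: "v \<in> pverts G" "w \<in> pverts G" if "adjacent G v w" for v w
      using that pair_wf_digraph.wellformed'[OF base_wf] by (auto simp: adjacent_def)
    have H: "x \<in> pverts (H i)" "y \<in> pverts (H i)" if "i \<in> {1..n}" "adjacent (H i) x y" for i x y
      using that pair_wf_digraph.wellformed'[OF fibre_wf] by (auto simp: adjacent_def)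
    show ?thesis
      using that adjacent_sym[OF base_sym] adjacent_sym[OF fibre_sym] u_in_base
      by (cases a; cases b) (auto dest: G H simp del: One_nat_def atLeastAtMost_iff)
  qed
  show "fst e \<in> pverts C" "snd e \<in> pverts C" if "e \<in> parcs C" for e
    using that arcs_in[of "fst e" "snd e"] by (simp_all add: adjacent_def)
  show "symmetric (with_proj C)"
    using arcs_in by (auto simp: symmetric_def sym_def adjacent_def)
qed

lemma corona_wf: "pair_wf_digraph C"
  using corona_sym by (simp add: pair_sym_digraph_def)

lemma finite_corona: "finite (pverts C)"
proof -
  interpret pair_graph G by (rule base_graph)
  have "pverts C \<subseteq> Inl ` pverts G \<union> (\<Union>i\<in>{1..n}. (\<lambda>x. Inr (i, x)) ` pverts (H i))"
    by (auto simp: generalized_corona_def)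
  then show ?thesis
    using pair_finite_verts finite_fibre by (auto intro: finite_subset)
qed

lemmas geodesic_corona_iff = geodesic_iff_shortest_walk[OF corona_wf]

lemma walk_into_copy_visits_base:
  assumes "walk_betw C a p (Inr (i, x))" "a \<notin> range (\<lambda>y. Inr (i, y))"
  shows "Inl (u i) \<in> set p"
  using assms
proof (induction p arbitrary: a)
  case (Cons c p)
  show ?case
  proof (cases p)
    case (Cons b p')
    with Cons.prems have ab: "c = a" "adjacent C a b" "walk_betw C b p (Inr (i, x))"
      by (auto simp: walk_betw_def)
    show ?thesis
    proof (cases "b \<in> range (\<lambda>y. Inr (i, y))")
      case True
      with ab(2) Cons.prems(2) have "a = Inl (u i)" by (cases a) auto
      with ab show ?thesis by simp
    next
      case False
      with Cons.IH[OF ab(3)] show ?thesis by simp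
    qed
  qed (use Cons.prems in \<open>auto simp: walk_betw_def\<close>)
qed (simp add: walk_betw_def)

text \<open>
  If \<open>a\<close> were outside the copy, the path would visit \<open>u i\<close> before \<open>Inr (i, x)\<close>. When \<open>b\<close> lies in the
  copy, going from \<open>u i\<close> straight to \<open>b\<close> is shorter; when \<open>b\<close> lies outside, the path visits \<open>u i\<close> a
  second time to get out.
\<close>

lemma geodesic_in_copy_starts_in_copy:
  assumes "geodesic C a b p" "Inr (i, x) \<in> set p" "Inr (i, x) \<noteq> b"
  shows "a \<in> range (\<lambda>y. Inr (i, y))"
proof (rule ccontr)
  assume a: "a \<notin> range (\<lambda>y. Inr (i, y))"
  from assms(1) have p: "walk_betw C a p b" and min: "\<And>q. walk_betw C a q b \<Longrightarrow> length p \<le> length q"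
    unfolding geodesic_corona_iff by blast+
  from assms(2) obtain p1 p2 where split: "p = p1 @ Inr (i, x) # p2"
    by (meson split_list)
  with p have w1: "walk_betw C a (p1 @ [Inr (i, x)]) (Inr (i, x))"
    and w2: "walk_betw C (Inr (i, x)) (Inr (i, x) # p2) b"
    using walk_betw_append_iff by fast+
  from w2 assms(3) have "p2 \<noteq> []" by (auto simp: walk_betw_def)
  from walk_into_copy_visits_base[OF w1 a] have "Inl (u i) \<in> set p1" by simp
  then obtain q1 q2 where q: "p1 = q1 @ Inl (u i) # q2" by (meson split_list)
  show False
  proof (cases "b \<in> range (\<lambda>y. Inr (i, y))")
    case True
    then obtain z where z: "b = Inr (i, z)" by blast
    have "b \<in> pverts C" using p by (auto simp: walk_betw_def)
    then have "walk_betw C (Inl (u i)) [Inl (u i), b] b"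
      unfolding short_walk_betw_iff[OF corona_wf] by (simp add: z)
    moreover have "walk_betw C a (q1 @ [Inl (u i)]) (Inl (u i))"
      using p walk_betw_append_iff[of C a q1 "Inl (u i)" "q2 @ Inr (i, x) # p2" b]
      by (simp add: split q)
    ultimately have "walk_betw C a (q1 @ [Inl (u i), b]) b"
      using walk_betw_append_iff by fast
    from min[OF this] show False
      using \<open>p2 \<noteq> []\<close> by (cases p2) (simp_all add: split q)
  next
    case False
    from walk_into_copy_visits_base[OF walk_betw_rev[OF corona_sym w2] False]
    have "Inl (u i) \<in> set p2" by simp
    moreover have "distinct p" using shortest_walk_distinct[OF p min] .
    ultimately show False by (simp add: split q)
  qed
qed

text \<open>
  By the previous lemma, applied in both directions, \<open>a\<close> and \<open>b\<close> lie in the copy; then \<open>a, u i, b\<close> is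
  a walk, which bounds the length of \<open>p\<close>.
\<close>

lemma geodesic_through_copy:
  assumes geo: "geodesic C a b p" and x: "Inr (i, x) \<in> set p" "Inr (i, x) \<noteq> a" "Inr (i, x) \<noteq> b"
  obtains y z where "a = Inr (i, y)" "b = Inr (i, z)" "p = [a, Inr (i, x), b]"
    "dist_two (H i) y z" "adjacent (H i) y x" "adjacent (H i) x z"
proof -
  from geo have p: "walk_betw C a p b" and min: "\<And>q. walk_betw C a q b \<Longrightarrow> length p \<le> length q"
    unfolding geodesic_corona_iff by blast+
  have "a \<in> range (\<lambda>y. Inr (i, y))"
    using geodesic_in_copy_starts_in_copy[OF geo x(1,3)] .
  moreover have "b \<in> range (\<lambda>y. Inr (i, y))"
    using geodesic_in_copy_starts_in_copy[OF geodesic_rev[OF corona_sym geo]] x by simp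
  ultimately obtain y z where yz: "a = Inr (i, y)" "b = Inr (i, z)" by blast
  have "a \<in> pverts C" "b \<in> pverts C" using p by (auto simp: walk_betw_def)
  then have i: "i \<in> {1..n}" and "walk_betw C a [a, Inl (u i), b] b"
    unfolding short_walk_betw_iff[OF corona_wf] by (simp_all add: yz)
  have "p \<noteq> []" using x by auto
  moreover have "length p \<le> 3" using min[OF \<open>walk_betw C a [a, Inl (u i), b] b\<close>] by simp
  ultimately have p3: "p = [a, Inr (i, x), b]"
    using p x by (cases rule: list_length_le_3_cases) (auto simp: walk_betw_def)
  with p have adj: "adjacent (H i) y x" "adjacent (H i) x z"
    using short_walk_betw_iff(3)[OF corona_wf] by (auto simp: yz)
  have "a \<noteq> b" using shortest_walk_distinct[OF p min] p3 by simp
  moreover have "\<not> adjacent C a b"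
    using min[of "[a, b]"] p3 short_walk_betw_iff(2)[OF corona_wf, of a a b b] by auto
  ultimately have "dist_two (H i) y z"
    using adj i by (auto simp: dist_two_def yz)
  with yz p3 adj show ?thesis using that by blast
qed

text \<open>
  Contracting each copy of \<open>H i\<close> to the vertex \<open>u i\<close> maps the corona onto \<open>G\<close>.
\<close>

primrec proj :: "'a + nat \<times> 'b \<Rightarrow> 'a" where
  "proj (Inl v) = v"
| "proj (Inr ix) = u (fst ix)"

text \<open>
  The projection of a walk repeats a vertex whenever the walk touches a copy of some \<open>H i\<close>. Removing
  these repetitions leaves a walk of \<open>G\<close> no longer than the part of the original walk that lies in
  \<open>G\<close>. A walk inside a single copy is the exception: its projection is one vertex, but no
  vertex of the walk lies in \<open>G\<close>.
\<close>

lemma walk_projection: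
  assumes "walk_betw C a q b"
  shows "proj a = proj b \<and> filter isl q = [] \<or>
    (\<exists>g. walk_betw G (proj a) g (proj b) \<and> length g \<le> length (filter isl q))"
  using assms
proof (induction q arbitrary: a)
  case (Cons c q)
  show ?case
  proof (cases q)
    case Nil
    with Cons.prems have "a = b" "c = a" "a \<in> pverts C" by (auto simp: walk_betw_def)
    then show ?thesis
      using Nil by (cases a) (auto intro!: exI[of _ "[proj a]"] simp: short_walk_betw_iff[OF base_wf])
  next
    case (Cons d q')
    with Cons.prems have ad: "c = a" "adjacent C a d" "walk_betw C d q b" "a \<in> pverts C"
      by (auto simp: walk_betw_def)
    note IH = Cons.IH[OF ad(3)]
    show ?thesis
    proof (cases a)
      case a: (Inl v)
      show ?thesis
      proof (cases d)
        case d: (Inl w)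
        with IH Cons obtain g where g: "walk_betw G w g (proj b)" "length g \<le> length (filter isl q)"
          by auto
        then obtain g' where "g = w # g'" by (cases g) (auto simp: walk_betw_def)
        with g ad a d have "walk_betw G v (v # g) (proj b)" by (auto simp: walk_betw_def)
        with g show ?thesis
          by (intro disjI2 exI[of _ "v # g"]) (simp add: a \<open>c = a\<close>)
      next
        case d: (Inr jy)
        with ad a have v: "v = proj d" by (cases jy) auto
        have "walk_betw G v [v] v"
          using ad a by (simp add: short_walk_betw_iff[OF base_wf])
        with IH v have "\<exists>g. walk_betw G v g (proj b) \<and> length g \<le> Suc (length (filter isl q))"
          by (metis Suc_leI le_SucI length_Cons list.size(3) zero_less_Suc le_refl)
        then show ?thesis by (simp add: a \<open>c = a\<close>)
      qed
    next
      case a: (Inr ix)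
      with ad have "proj d = proj a" by (cases ix; cases d) auto
      with IH show ?thesis by (simp add: a \<open>c = a\<close>)
    qed
  qed
qed (simp add: walk_betw_def)

text \<open>
  By the projection, a walk between two different copies visits \<open>G\<close> at least as often as a geodesic of
  \<open>G\<close> from \<open>u i\<close> to \<open>u j\<close> has vertices, and its two ends come on top of that.
\<close>

lemma geodesic_between_copies:
  assumes ij: "i \<in> {1..n}" "j \<in> {1..n}" "i \<noteq> j" and xy: "x \<in> pverts (H i)" "y \<in> pverts (H j)"
    and g: "geodesic G (u i) (u j) g"
  shows "geodesic C (Inr (i, x)) (Inr (j, y)) (Inr (i, x) # map Inl g @ [Inr (j, y)])"
    (is "geodesic C ?a ?b ?p")
  unfolding geodesic_corona_iff
proof (intro conjI allI impI)
  from g have walk: "walk_betw G (u i) g (u j)" and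
    min: "\<And>q. walk_betw G (u i) q (u j) \<Longrightarrow> length g \<le> length q"
    unfolding geodesic_iff_shortest_walk[OF base_wf] by blast+
  from walk have "successively (\<lambda>v w. adjacent C (Inl v) (Inl w)) g"
    by (simp add: walk_betw_def)
  then show "walk_betw C ?a ?p ?b"
    using walk ij xy
    by (auto simp: walk_betw_def successively_append_iff successively_Cons successively_map
        hd_append hd_map last_map)
  fix q assume q: "walk_betw C ?a q ?b"
  obtain g' where "walk_betw G (u i) g' (u j)" "length g' \<le> length (filter isl q)"
    using walk_projection[OF q] u_inj[OF ij(1,2)] ij(3) by auto
  with min have len: "length g \<le> length (filter isl q)" by fastforce
  obtain c q' where q': "q = c # q'" using q by (cases q) (auto simp: walk_betw_def)
  with q ij have "c = ?a" "q' \<noteq> []" by (auto simp: walk_betw_def)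
  with q q' obtain q'' where q'': "q = ?a # q'' @ [?b]"
    by (metis append_butlast_last_id last_ConsR walk_betw_def)
  with len have "length g \<le> length (filter isl q'')" by simp
  also have "\<dots> \<le> length q''" by simp
  finally show "length ?p \<le> length q" by (simp add: q'')
qed

section \<open>Strong geodetic sets of the generalized corona\<close>

text \<open>
  By \<open>geodesic_through_copy\<close>, the geodesics fixed in the corona that cover vertices of the copy of
  \<open>H i\<close> are paths \<open>y, w, z\<close> in \<open>H i\<close>, whose middle vertices \<open>w\<close> are selected. For other pairs at
  distance \<open>2\<close> in \<open>H i\<close>, whose fixed geodesic may pass through \<open>u i\<close>, any common neighbour will do.
\<close>

lemma trace_strong_2_geodetic:
  assumes S: "strong_geodetic_set C S" and i: "i \<in> {1..n}"
  shows "strong_2_geodetic_set (H i) {x. Inr (i, x) \<in> S}" (is "strong_2_geodetic_set _ ?T")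
proof -
  from S have sub: "S \<subseteq> pverts C" by (simp add: strong_geodetic_set_def)
  from S obtain P where
    P: "\<And>a b. a \<in> S \<Longrightarrow> b \<in> S \<Longrightarrow> a \<noteq> b \<Longrightarrow> geodesic C a b (P a b) \<and> P b a = rev (P a b)"
    and cover: "\<And>v. v \<in> pverts C - S \<Longrightarrow> \<exists>a\<in>S. \<exists>b\<in>S. a \<noteq> b \<and> v \<in> set (P a b)"
    unfolding strong_geodetic_set_def by blast
  define common where "common x y = (\<lambda>w. adjacent (H i) x w \<and> adjacent (H i) w y)" for x y
  define through where
    "through x y = (\<lambda>w. common x y w \<and> P (Inr (i, x)) (Inr (i, y)) = [Inr (i, x), Inr (i, w), Inr (i, y)])"
    for x y
  \<comment> \<open>Hilbert choice is applied to predicates that are symmetric in \<open>x\<close> and \<open>y\<close>, which makes the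
    selected vertex symmetric as well.\<close>
  define m where "m x y = (if Ex (through x y) then Eps (through x y) else Eps (common x y))" for x y
  have common_sym: "common y x = common x y" for x y
    using adjacent_sym[OF fibre_sym[OF i]] by (auto simp: common_def fun_eq_iff)
  have through_sym: "through y x = through x y" if "x \<in> ?T" "y \<in> ?T" "x \<noteq> y" for x y
    using P[of "Inr (i, x)" "Inr (i, y)"] that common_sym[of x y]
    by (auto simp: through_def fun_eq_iff)
  show ?thesis
    unfolding strong_2_geodetic_set_iff_middles[OF fibre_graph[OF i]] middle_selection_def
  proof (intro conjI exI[of _ m] ballI impI)
    show "?T \<subseteq> pverts (H i)" using sub by auto
  next
    fix x y assume xy: "x \<in> ?T" "y \<in> ?T" "dist_two (H i) x y"
    then have "Ex (common x y)" by (auto simp: dist_two_def common_def)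
    then have "common x y (m x y)"
      unfolding m_def by (auto intro: someI_ex) (metis someI_ex through_def)
    then show "adjacent (H i) x (m x y)" "adjacent (H i) (m x y) y" by (simp_all add: common_def)
    from xy have "x \<noteq> y" by (simp add: dist_two_def)
    show "m y x = m x y"
      unfolding m_def through_sym[OF xy(1,2) \<open>x \<noteq> y\<close>] common_sym[of x y] by (rule refl)
  next
    fix x assume x: "x \<in> pverts (H i) - ?T"
    with i have "Inr (i, x) \<in> pverts C - S" by simp
    from cover[OF this] obtain a b where ab: "a \<in> S" "b \<in> S" "a \<noteq> b" "Inr (i, x) \<in> set (P a b)"
      by blast
    have "Inr (i, x) \<noteq> a" "Inr (i, x) \<noteq> b" using x ab by auto
    with geodesic_through_copy[OF conjunct1[OF P[OF ab(1-3)]] ab(4)] obtain y z where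
      yz: "a = Inr (i, y)" "b = Inr (i, z)" "P a b = [a, Inr (i, x), b]"
        "dist_two (H i) y z" "adjacent (H i) y x" "adjacent (H i) x z"
      by blast
    then have "through y z = (\<lambda>w. w = x)" by (auto simp: through_def common_def fun_eq_iff)
    then have "m y z = x" by (simp add: m_def)
    with yz ab show "\<exists>y\<in>?T. \<exists>z\<in>?T. dist_two (H i) y z \<and> x = m y z" by auto
  qed
qed

lemma sum_traces_le_card:
  assumes "S \<subseteq> pverts C"
  shows "(\<Sum>i=1..n. card {x. Inr (i, x) \<in> S}) \<le> card S"
proof -
  have fin: "finite S" using assms finite_corona by (rule finite_subset)
  have finT: "finite {x. Inr (i, x) \<in> S}" for i
    using finite_vimageI[OF fin, of "\<lambda>x. Inr (i, x)"] by (simp add: vimage_def inj_on_def)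
  have "(\<Sum>i=1..n. card {x. Inr (i, x) \<in> S}) = card (SIGMA i:{1..n}. {x. Inr (i, x) \<in> S})"
    using finT by simp
  also have "\<dots> = card (Inr ` (SIGMA i:{1..n}. {x. Inr (i, x) \<in> S}) :: ('a + nat \<times> 'b) set)"
    by (simp add: card_image)
  also have "\<dots> \<le> card S"
    using fin by (intro card_mono) auto
  finally show ?thesis .
qed

text \<open>
  The vertices \<open>u i\<close> are covered by geodesics between different copies, which requires \<open>n \<ge> 2\<close>.
\<close>

lemma union_strong_geodetic:
  assumes \<eta>: "\<And>i. i \<in> {1..n} \<Longrightarrow> strong_2_geodetic_set (H i) (\<eta> i)"
    and n: "2 \<le> n"
  shows "strong_geodetic_set C (\<Union>i\<in>{1..n}. (\<lambda>b. Inr (i, b)) ` \<eta> i)"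
    (is "strong_geodetic_set C ?S")
proof -
  have in_S [simp]: "Inr (i, x) \<in> ?S \<longleftrightarrow> i \<in> {1..n} \<and> x \<in> \<eta> i" "Inl v \<notin> ?S" for i x v
    by auto
  have sub: "\<eta> i \<subseteq> pverts (H i)" if "i \<in> {1..n}" for i
    using \<eta>[OF that] by (simp add: strong_2_geodetic_set_def)
  have "\<exists>m. \<forall>i\<in>{1..n}. middle_selection (H i) (\<eta> i) (m i)"
  proof (intro bchoice ballI)
    fix i assume "i \<in> {1..n}"
    with \<eta> show "\<exists>m. middle_selection (H i) (\<eta> i) m"
      using strong_2_geodetic_set_iff_middles[OF fibre_graph, of i "\<eta> i"] by blast
  qed
  then obtain m where sel: "\<And>i. i \<in> {1..n} \<Longrightarrow> middle_selection (H i) (\<eta> i) (m i)"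
    by blast
  have m: "adjacent (H i) s (m i s t) \<and> adjacent (H i) (m i s t) t \<and> m i t s = m i s t"
    if "i \<in> {1..n}" "s \<in> \<eta> i" "t \<in> \<eta> i" "dist_two (H i) s t" for i s t
    using sel[OF that(1)] that(2-) by (simp add: middle_selection_def)
  have m_cover: "\<exists>s\<in>\<eta> i. \<exists>t\<in>\<eta> i. dist_two (H i) s t \<and> v = m i s t"
    if "i \<in> {1..n}" "v \<in> pverts (H i) - \<eta> i" for i v
    using sel[OF that(1)] that(2) by (simp add: middle_selection_def)
  define R where "R i j = (SOME g. geodesic G (u i) (u j) g)" for i j
  have R: "geodesic G (u i) (u j) (R i j)" if "i \<in> {1..n}" "j \<in> {1..n}" for i j
    unfolding R_def by (rule someI_ex, rule ex_geodesic[OF base u_in_base u_in_base]) (use that in simp_all)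
  \<comment> \<open>The reverse direction of a pair of copies has to use the same geodesic of \<open>G\<close> backwards.\<close>
  define R' where "R' i j = (if i < j then R i j else rev (R j i))" for i j
  have R': "geodesic G (u i) (u j) (R' i j)" if "i \<in> {1..n}" "j \<in> {1..n}" for i j
    using that R geodesic_rev[OF base_sym R[of j i]] by (auto simp: R'_def)
  have R'_rev: "R' j i = rev (R' i j)" if "i \<noteq> j" for i j
    using that by (auto simp: R'_def)
  \<comment> \<open>Vertices of \<open>H i\<close> at distance \<open>3\<close> or more come to distance \<open>2\<close> in the corona, through \<open>u i\<close>.\<close>
  define Q where "Q i x j y =
      (if i \<noteq> j then Inr (i, x) # map Inl (R' i j) @ [Inr (j, y)]
       else if adjacent (H i) x y then [Inr (i, x), Inr (i, y)]
       else if dist_two (H i) x y then [Inr (i, x), Inr (i, m i x y), Inr (i, y)]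
       else [Inr (i, x), Inl (u i), Inr (i, y)])" for i x j y
  define P :: "'a + nat \<times> 'b \<Rightarrow> 'a + nat \<times> 'b \<Rightarrow> ('a + nat \<times> 'b) list"
    where "P a b = Q (fst (projr a)) (snd (projr a)) (fst (projr b)) (snd (projr b))" for a b
  have Q_geodesic: "geodesic C (Inr (i, x)) (Inr (j, y)) (Q i x j y)"
    if ij: "i \<in> {1..n}" "j \<in> {1..n}" and xy: "x \<in> \<eta> i" "y \<in> \<eta> j" "(i, x) \<noteq> (j, y)" for i x j y
  proof -
    have V: "x \<in> pverts (H i)" "y \<in> pverts (H j)" using sub ij xy by auto
    show ?thesis
    proof (cases "i = j")
      case False
      with geodesic_between_copies[OF ij False V R'[OF ij]] show ?thesis by (simp add: Q_def)
    next
      case [simp]: True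
      show ?thesis
      proof (cases "adjacent (H i) x y")
        case True
        with geodesic_adjacent_iff[OF corona_wf, of "Inr (i, x)" "Inr (i, y)"] xy ij
        show ?thesis by (simp add: Q_def)
      next
        case False
        \<comment> \<open>In the corona any two nonadjacent vertices of the copy have the common neighbour \<open>u i\<close>.\<close>
        have "dist_two C (Inr (i, x)) (Inr (i, y))"
          unfolding dist_two_def using False xy ij V by (auto intro!: exI[of _ "Inl (u i)"])
        from geodesic_dist_two_iff[OF corona_wf this] show ?thesis
          using False xy ij V m[of i x y] by (auto simp: Q_def)
      qed
    qed
  qed
  have Q_rev: "Q j y i x = rev (Q i x j y)"
    if ij: "i \<in> {1..n}" "j \<in> {1..n}" and xy: "x \<in> \<eta> i" "y \<in> \<eta> j" for i x j y
    using R'_rev[of i j] adjacent_sym[OF fibre_sym[OF ij(1)], of x y]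
      dist_two_sym[OF fibre_sym[OF ij(1)], of x y] m[of i x y] that
    by (auto simp: Q_def rev_map)
  show ?thesis
    unfolding strong_geodetic_set_def
  proof (intro conjI exI[of _ P] ballI impI)
    show "?S \<subseteq> pverts C" by (auto dest: subsetD[OF sub] simp del: atLeastAtMost_iff One_nat_def)
  next
    fix a b assume ab: "a \<in> ?S" "b \<in> ?S" "a \<noteq> b"
    then obtain i x j y where a: "a = Inr (i, x)" and b: "b = Inr (j, y)"
      and ij: "i \<in> {1..n}" "j \<in> {1..n}" and xy: "x \<in> \<eta> i" "y \<in> \<eta> j" by blast
    have PQ: "P a b = Q i x j y" "P b a = Q j y i x" by (simp_all add: P_def a b)
    have "(i, x) \<noteq> (j, y)" using ab(3) a b by simp
    then show "geodesic C a b (P a b)"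
      unfolding PQ unfolding a b by (rule Q_geodesic[OF ij xy])
    show "P b a = rev (P a b)"
      unfolding PQ by (rule Q_rev[OF ij xy])
  next
    fix v assume v: "v \<in> pverts C - ?S"
    show "\<exists>a\<in>?S. \<exists>b\<in>?S. a \<noteq> b \<and> v \<in> set (P a b)"
    proof (cases v)
      case (Inr ix)
      then obtain i x where ix: "v = Inr (i, x)" by (cases ix) auto
      with v have i: "i \<in> {1..n}" "x \<in> pverts (H i) - \<eta> i" by (auto simp del: in_S simp: in_S(1))
      from m_cover[OF this] obtain s t where st: "s \<in> \<eta> i" "t \<in> \<eta> i" "dist_two (H i) s t" "x = m i s t"
        by blast
      then have "v \<in> set (P (Inr (i, s)) (Inr (i, t)))" "s \<noteq> t"
        by (auto simp: P_def Q_def ix dist_two_def)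
      then have "Inr (i, s) \<noteq> Inr (i, t) \<and> v \<in> set (P (Inr (i, s)) (Inr (i, t)))" by simp
      moreover have "Inr (i, s) \<in> ?S" "Inr (i, t) \<in> ?S" using st i by auto
      ultimately show ?thesis by (intro bexI)
    next
      case (Inl w)
      with v have "w \<in> pverts G" by simp
      then obtain i where i: "i \<in> {1..n}" "w = u i"
        using bij_betw_imp_surj_on[OF u_bij] by blast
      obtain j where j: "j \<in> {1..n}" "j \<noteq> i"
        using n by (cases "i = 1") (auto intro: that[of 1] that[of 2])
      have ne: "\<eta> k \<noteq> {}" if "k \<in> {1..n}" for k
        using strong_2_geodetic_set_nonempty[OF \<eta>[OF that]] fibre[OF that]
        by (cases "pverts (H k) = {}") (auto simp: connected_simple_graph_def)
      obtain x y where xy: "x \<in> \<eta> i" "y \<in> \<eta> j" using ne i(1) j(1) by blast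
      have "walk_betw G (u i) (R' i j) (u j)"
        using R'[OF i(1) j(1)] geodesic_iff_shortest_walk[OF base_wf] by blast
      then have "u i \<in> set (R' i j)" unfolding walk_betw_def by (metis hd_in_set)
      then have "v \<in> set (P (Inr (i, x)) (Inr (j, y)))"
        using j by (simp add: P_def Q_def Inl i)
      then have "Inr (i, x) \<noteq> Inr (j, y) \<and> v \<in> set (P (Inr (i, x)) (Inr (j, y)))"
        using j by simp
      moreover have "Inr (i, x) \<in> ?S" "Inr (j, y) \<in> ?S" using xy i j by auto
      ultimately show ?thesis by (intro bexI)
    qed
  qed
qed

lemma card_union_copies:
  assumes "\<And>i. i \<in> {1..n} \<Longrightarrow> \<eta> i \<subseteq> pverts (H i)"
  shows "card (\<Union>i\<in>{1..n}. (\<lambda>b. Inr (i, b) :: 'a + nat \<times> 'b) ` \<eta> i) = (\<Sum>i=1..n. card (\<eta> i))"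
proof -
  have "finite (\<eta> i)" if "i \<in> {1..n}" for i
    using assms[OF that] finite_fibre[OF that] by (rule finite_subset)
  then have "card (\<Union>i\<in>{1..n}. (\<lambda>b. Inr (i, b) :: 'a + nat \<times> 'b) ` \<eta> i)
    = (\<Sum>i=1..n. card ((\<lambda>b. Inr (i, b) :: 'a + nat \<times> 'b) ` \<eta> i))"
    by (intro card_UN_disjoint) auto
  also have "\<dots> = (\<Sum>i=1..n. card (\<eta> i))"
    by (intro sum.cong card_image) (auto simp: inj_on_def)
  finally show ?thesis .
qed

end

theorem theorem2p6:
  fixes G :: "'a pair_pre_digraph"
    and n :: nat
    and u :: "nat \<Rightarrow> 'a"
    and H :: "nat \<Rightarrow> 'b pair_pre_digraph"
    and \<eta> :: "nat \<Rightarrow> 'b set"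
    and s :: "nat \<Rightarrow> nat"
  assumes "connected_simple_graph G"
    and "card (pverts G) = n"
    and "bij_betw u {1..n} (pverts G)"
    and "\<And>i. i \<in> {1..n} \<Longrightarrow> connected_simple_graph (H i)"
    and "\<And>i. i \<in> {1..n} \<Longrightarrow> strong_2_geodetic_basis (H i) (\<eta> i)"
    and "\<And>i. i \<in> {1..n} \<Longrightarrow> card (\<eta> i) = s i"
  shows "strong_geodetic_basis (generalized_corona G n u H) (\<Union>i\<in>{1..n}. (\<lambda>b. Inr (i, b)) ` \<eta> i)
    \<and> strong_geodetic_number (generalized_corona G n u H) = (\<Sum>i=1..n. s i)"
proof -
  interpret corona G n u H
    using assms by unfold_locales auto
  let ?S = "\<Union>i\<in>{1..n}. (\<lambda>b. Inr (i, b) :: 'a + nat \<times> 'b) ` \<eta> i"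
  have n: "2 \<le> n" using assms(1,2) by (simp add: connected_simple_graph_def)
  have \<eta>: "strong_2_geodetic_set (H i) (\<eta> i)" if "i \<in> {1..n}" for i
    using assms(5)[OF that] by (simp add: strong_2_geodetic_basis_def)
  have min: "s i \<le> card T" if "i \<in> {1..n}" "strong_2_geodetic_set (H i) T" for i T
  proof -
    have "s i = strong_2_geodetic_number (H i)"
      using assms(5,6)[OF that(1)] by (simp add: strong_2_geodetic_basis_def)
    also have "\<dots> \<le> card T"
      unfolding strong_2_geodetic_number_def using that(2) by (intro Least_le) blast
    finally show ?thesis .
  qed
  have S: "strong_geodetic_set C ?S"
    using \<eta> n by (rule union_strong_geodetic)
  have card_S: "card ?S = (\<Sum>i=1..n. s i)"
    using card_union_copies[of \<eta>] \<eta> assms(6) by (simp add: strong_2_geodetic_set_def)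
  have "(\<Sum>i=1..n. s i) \<le> card S'" if S': "strong_geodetic_set C S'" for S'
  proof -
    have "(\<Sum>i=1..n. s i) \<le> (\<Sum>i=1..n. card {x. Inr (i, x) \<in> S'})"
      using trace_strong_2_geodetic[OF S'] by (intro sum_mono min)
    also have "\<dots> \<le> card S'"
      using S' by (intro sum_traces_le_card) (simp add: strong_geodetic_set_def)
    finally show ?thesis .
  qed
  then have "strong_geodetic_number C = (\<Sum>i=1..n. s i)"
    unfolding strong_geodetic_number_def using S card_S by (intro Least_equality) auto
  with S card_S show ?thesis by (simp add: strong_geodetic_basis_def)
qed

end
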